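(* Let $E_1,\dots,E_m$ be normed spaces and let $F$ be a Banach space, all over $\mathbb{K}=\mathbb{R}$ or $\mathbb{C}$. If $M$ is a closed subset of $\mathcal{L}(F^*,\mathcal{L}(E_1,\dots,E_m;\mathbb{K}))$, then the set $M_*:=\{A\in\mathcal{L}(E_1,\dots,E_m;F) : A^*\in M\}$ is a closed subset of $\mathcal{L}(E_1,\dots,E_m;F)$. In particular, if $M$ is a closed subspace, then $M_*$ is a closed subspace as well.
   Context: $\mathcal{L}(E_1,\dots,E_m;F)$ is the space of continuous $m$-linear operators $E_1\times\cdots\times E_m\to F$ with the usual sup norm $\|A\|=\sup\{\|A(x_1,\dots,x_m)\| : \|x_i\|\le 1\}$; $\mathcal{L}(X,Y)$ is the space of bounded linear operators with the operator norm; $F^*$ is the topological dual of $F$. The adjoint of $A\in\mathcal{L}(E_1,\dots,E_m;F)$ is the bounded linear operator $A^*\colon F^*\to\mathcal{L}(E_1,\dots,E_m;\mathbb{K})$ given by $A^*(y^* )(x_1,\dots,x_m)=y^*(A(x_1,\dots,x_m))$. *)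

theory Defs
  imports "HOL-Analysis.Analysis" "HOL-Algebra.Module"
begin

text \<open>
  Normed spaces are carrier-based, extending the module records of HOL-Algebra: the spaces
  \<open>E\<^sub>1, \<dots>, E\<^sub>m\<close> carry unrelated structures and \<open>m\<close> is arbitrary, so they form one family of
  records over a common type of elements. The scalar field \<open>\<K>\<close> is the set \<open>\<real>\<close> or the set \<open>UNIV\<close>
  of complex numbers. The ring multiplication and unit of a module record play no role in the
  theory of modules; they are left unspecified in the operator spaces.
\<close>

record 'a normed_module = "(complex, 'a) module" +
  nrm :: "'a \<Rightarrow> real"

text \<open>The field \<open>\<K>\<close>, as a ring of scalars and also as a normed space over itself.\<close>

definition scalars :: "complex set \<Rightarrow> complex normed_module" where
  "scalars K = \<lparr>carrier = K, mult = (*), one = 1, zero = 0, add = (+), smult = (*), nrm = cmod\<rparr>"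

locale normed_space = Module.module "scalars K" V
  for K :: "complex set" and V :: "'a normed_module" (structure) +
  assumes nrm_nonneg: "x \<in> carrier V \<Longrightarrow> 0 \<le> nrm V x"
    and nrm_eq_0_iff: "x \<in> carrier V \<Longrightarrow> nrm V x = 0 \<longleftrightarrow> x = \<zero>"
    and nrm_smult: "a \<in> K \<Longrightarrow> x \<in> carrier V \<Longrightarrow> nrm V (a \<odot> x) = cmod a * nrm V x"
    and nrm_triangle: "x \<in> carrier V \<Longrightarrow> y \<in> carrier V \<Longrightarrow> nrm V (x \<oplus> y) \<le> nrm V x + nrm V y"

text \<open>
  The value 0 off the carrier is needed because \<^locale>\<open>Metric_space\<close> requires nonnegativity and
  symmetry on the whole type.
\<close>

definition nrm_dist :: "'a normed_module \<Rightarrow> 'a \<Rightarrow> 'a \<Rightarrow> real" where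
  "nrm_dist V x y = (if x \<in> carrier V \<and> y \<in> carrier V then nrm V (x \<ominus>\<^bsub>V\<^esub> y) else 0)"

definition nrm_topology :: "'a normed_module \<Rightarrow> 'a topology" where
  "nrm_topology V = Metric_space.mtopology (carrier V) (nrm_dist V)"

locale banach_space = normed_space +
  assumes complete: "Metric_space.mcomplete (carrier V) (nrm_dist V)"

text \<open>
  Operators are extensional functions (\<^const>\<open>undefined\<close> outside their domain), so that equality in
  an operator space is equality of operators.
\<close>

definition linear_op ::
  "complex set \<Rightarrow> 'a normed_module \<Rightarrow> 'b normed_module \<Rightarrow> ('a \<Rightarrow> 'b) \<Rightarrow> bool" where
  "linear_op K X Y T \<longleftrightarrow>
     T \<in> carrier X \<rightarrow>\<^sub>E carrier Y \<and>
     (\<forall>x\<in>carrier X. \<forall>y\<in>carrier X. T (x \<oplus>\<^bsub>X\<^esub> y) = T x \<oplus>\<^bsub>Y\<^esub> T y) \<and>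
     (\<forall>a\<in>K. \<forall>x\<in>carrier X. T (a \<odot>\<^bsub>X\<^esub> x) = a \<odot>\<^bsub>Y\<^esub> T x)"

definition bounded_ops ::
  "complex set \<Rightarrow> 'a normed_module \<Rightarrow> 'b normed_module \<Rightarrow> ('a \<Rightarrow> 'b) normed_module" where
  "bounded_ops K X Y =
     \<lparr>carrier = {T. linear_op K X Y T \<and> (\<exists>C. \<forall>x\<in>carrier X. nrm Y (T x) \<le> C * nrm X x)},
      mult = undefined, one = undefined,
      zero = (\<lambda>x\<in>carrier X. \<zero>\<^bsub>Y\<^esub>),
      add = (\<lambda>S T. \<lambda>x\<in>carrier X. S x \<oplus>\<^bsub>Y\<^esub> T x),
      smult = (\<lambda>a T. \<lambda>x\<in>carrier X. a \<odot>\<^bsub>Y\<^esub> T x),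
      nrm = (\<lambda>T. SUP x\<in>{x \<in> carrier X. nrm X x \<le> 1}. nrm Y (T x))\<rparr>"

definition dual :: "complex set \<Rightarrow> 'a normed_module \<Rightarrow> ('a \<Rightarrow> complex) normed_module" where
  "dual K X = bounded_ops K X (scalars K)"

text \<open>
  Points of \<open>E\<^sub>1 \<times> \<dots> \<times> E\<^sub>m\<close> are extensional functions on \<open>{1..m}\<close>, the carrier of
  \<^const>\<open>product_topology\<close>.
\<close>

definition prod_carrier :: "nat \<Rightarrow> (nat \<Rightarrow> 'a normed_module) \<Rightarrow> (nat \<Rightarrow> 'a) set" where
  "prod_carrier m E = (\<Pi>\<^sub>E i\<in>{1..m}. carrier (E i))"

definition multilinear_op ::
  "complex set \<Rightarrow> nat \<Rightarrow> (nat \<Rightarrow> 'a normed_module) \<Rightarrow> 'b normed_module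
    \<Rightarrow> ((nat \<Rightarrow> 'a) \<Rightarrow> 'b) \<Rightarrow> bool" where
  "multilinear_op K m E F A \<longleftrightarrow>
     A \<in> prod_carrier m E \<rightarrow>\<^sub>E carrier F \<and>
     (\<forall>x\<in>prod_carrier m E. \<forall>i\<in>{1..m}. \<forall>u\<in>carrier (E i). \<forall>v\<in>carrier (E i).
        A (x(i := u \<oplus>\<^bsub>E i\<^esub> v)) = A (x(i := u)) \<oplus>\<^bsub>F\<^esub> A (x(i := v))) \<and>
     (\<forall>x\<in>prod_carrier m E. \<forall>i\<in>{1..m}. \<forall>a\<in>K. \<forall>u\<in>carrier (E i).
        A (x(i := a \<odot>\<^bsub>E i\<^esub> u)) = a \<odot>\<^bsub>F\<^esub> A (x(i := u)))"

definition multilinear_ops ::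
  "complex set \<Rightarrow> nat \<Rightarrow> (nat \<Rightarrow> 'a normed_module) \<Rightarrow> 'b normed_module
    \<Rightarrow> ((nat \<Rightarrow> 'a) \<Rightarrow> 'b) normed_module" where
  "multilinear_ops K m E F =
     \<lparr>carrier = {A. multilinear_op K m E F A \<and>
        continuous_map (product_topology (\<lambda>i. nrm_topology (E i)) {1..m}) (nrm_topology F) A},
      mult = undefined, one = undefined,
      zero = (\<lambda>x\<in>prod_carrier m E. \<zero>\<^bsub>F\<^esub>),
      add = (\<lambda>A B. \<lambda>x\<in>prod_carrier m E. A x \<oplus>\<^bsub>F\<^esub> B x),
      smult = (\<lambda>a A. \<lambda>x\<in>prod_carrier m E. a \<odot>\<^bsub>F\<^esub> A x),
      nrm = (\<lambda>A. SUP x\<in>{x \<in> prod_carrier m E. \<forall>i\<in>{1..m}. nrm (E i) (x i) \<le> 1}. nrm F (A x))\<rparr>"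

definition adjoint ::
  "complex set \<Rightarrow> nat \<Rightarrow> (nat \<Rightarrow> 'a normed_module) \<Rightarrow> 'b normed_module
    \<Rightarrow> ((nat \<Rightarrow> 'a) \<Rightarrow> 'b) \<Rightarrow> ('b \<Rightarrow> complex) \<Rightarrow> (nat \<Rightarrow> 'a) \<Rightarrow> complex" where
  "adjoint K m E F A = (\<lambda>\<phi>\<in>carrier (dual K F). \<lambda>x\<in>prod_carrier m E. \<phi> (A x))"

text \<open>The space \<open>\<L>(F\<^sup>*, \<L>(E\<^sub>1, \<dots>, E\<^sub>m; \<K>))\<close> to which adjoints belong.\<close>

definition adjoint_space ::
  "complex set \<Rightarrow> nat \<Rightarrow> (nat \<Rightarrow> 'a normed_module) \<Rightarrow> 'b normed_module
    \<Rightarrow> (('b \<Rightarrow> complex) \<Rightarrow> (nat \<Rightarrow> 'a) \<Rightarrow> complex) normed_module" where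
  "adjoint_space K m E F = bounded_ops K (dual K F) (multilinear_ops K m E (scalars K))"

definition lower_star ::
  "complex set \<Rightarrow> nat \<Rightarrow> (nat \<Rightarrow> 'a normed_module) \<Rightarrow> 'b normed_module
    \<Rightarrow> (('b \<Rightarrow> complex) \<Rightarrow> (nat \<Rightarrow> 'a) \<Rightarrow> complex) set \<Rightarrow> ((nat \<Rightarrow> 'a) \<Rightarrow> 'b) set" where
  "lower_star K m E F M = {A \<in> carrier (multilinear_ops K m E F). adjoint K m E F A \<in> M}"

lemma scalars_cring:
  assumes "K = \<real> \<or> K = UNIV" shows "Ring.cring (scalars K)"
proof -
  have "\<exists>y\<in>K. y + x = 0 \<and> x + y = 0" if "x \<in> K" for x
    using that assms by (intro bexI[of _ "- x"]) auto
  then show ?thesis using assms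
    by (unfold_locales) (auto simp: scalars_def algebra_simps Units_def)
qed

lemma scalars_normed_space:
  assumes "K = \<real> \<or> K = UNIV" shows "normed_space K (scalars K)"
proof -
  interpret Ring.cring "scalars K" using scalars_cring[OF assms] .
  show ?thesis using assms
    by unfold_locales (auto simp: scalars_def algebra_simps norm_mult norm_triangle_ineq)
qed

end

theory Submission
  imports Defs
begin

text \<open>
  The map \<open>A \<mapsto> A\<^sup>*\<close> is a bounded linear operator from \<open>\<L>(E\<^sub>1, \<dots>, E\<^sub>m; F)\<close> to
  \<open>\<L>(F\<^sup>*, \<L>(E\<^sub>1, \<dots>, E\<^sub>m; \<K>))\<close>, of norm at most 1 because \<open>\<bar>\<phi> (A x)\<bar> \<le> \<parallel>\<phi>\<parallel> \<parallel>A\<parallel>\<close> when all \<open>\<parallel>x\<^sub>i\<parallel> \<le> 1\<close>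
  (\<open>adjoint_bounded_op\<close>). It is therefore continuous (\<open>bounded_op_continuous\<close>), and \<open>M\<^sub>*\<close> is the preimage
  of \<open>M\<close> under it: closed if \<open>M\<close> is closed, and a subspace if \<open>M\<close> is one
  (\<open>linear_op_preimage_submodule\<close>).

  For these words to apply, the operator spaces have to be normed spaces, in particular metric
  spaces. The supremum over the unit ball satisfies the norm laws as soon as operators are bounded
  on the ball and determined by their values there (\<open>pointwise_sup_normed_space\<close>). For multilinear
  operators both properties come from rescaling each variable separately: boundedness follows from
  continuity at the origin (\<open>multilinear_op_bounded_on_ball\<close>), and an operator that vanishes on the
  ball vanishes everywhere (\<open>multilinear_op_zero_on_ball\<close>).
\<close>

section \<open>Normed spaces as metric spaces\<close>

lemma scalars_simps [simp]:
  "carrier (scalars K) = K" "mult (scalars K) = (*)" "one (scalars K) = 1"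
  "zero (scalars K) = 0" "add (scalars K) = (+)" "smult (scalars K) = (*)"
  "nrm (scalars K) = cmod"
  by (simp_all add: scalars_def)

context normed_space
begin

lemma nrm_zero [simp]: "nrm V \<zero> = 0"
  using nrm_eq_0_iff by simp

lemma scalars_contain: "0 \<in> K" "1 \<in> K" "- 1 \<in> K"
proof -
  show k: "0 \<in> K" "1 \<in> K" using R.zero_closed R.one_closed by simp_all
  have "(\<ominus>\<^bsub>scalars K\<^esub> 1) + 1 = 0" "\<ominus>\<^bsub>scalars K\<^esub> 1 \<in> K"
    using R.l_neg[of 1] R.a_inv_closed[of 1] k by simp_all
  then show "- 1 \<in> K" by (metis eq_neg_iff_add_eq_0)
qed

lemma a_inv_eq_smult: assumes "x \<in> carrier V" shows "\<ominus> x = (- 1) \<odot> x"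
proof (rule M.minus_equality)
  show "((- 1) \<odot> x) \<oplus> x = \<zero>"
    using smult_l_distr[of "- 1" 1 x] smult_one[of x] smult_l_null[of x] scalars_contain assms by simp
  show "(- 1) \<odot> x \<in> carrier V" using smult_closed[of "- 1" x] scalars_contain assms by simp
qed (fact assms)

lemma nrm_a_inv: "x \<in> carrier V \<Longrightarrow> nrm V (\<ominus> x) = nrm V x"
  using nrm_smult[of "- 1" x] scalars_contain by (simp add: a_inv_eq_smult)

sublocale metric: Metric_space "carrier V" "nrm_dist V"
proof
  fix x y z
  show "0 \<le> nrm_dist V x y" by (simp add: nrm_dist_def nrm_nonneg)
  show "nrm_dist V x y = nrm_dist V y x"
  proof (cases "x \<in> carrier V \<and> y \<in> carrier V")
    case True
    then have "x \<ominus> y = \<ominus> (y \<ominus> x)"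
      by (simp add: a_minus_def M.minus_add M.a_comm)
    then show ?thesis using True nrm_a_inv[of "y \<ominus> x"] by (simp add: nrm_dist_def)
  qed (auto simp: nrm_dist_def)
  show "nrm_dist V x y = 0 \<longleftrightarrow> x = y" if "x \<in> carrier V" "y \<in> carrier V"
    using that M.minus_equality[of x "\<ominus> y"]
    by (auto simp: nrm_dist_def nrm_eq_0_iff a_minus_def M.r_neg)
  show "nrm_dist V x z \<le> nrm_dist V x y + nrm_dist V y z"
    if "x \<in> carrier V" "y \<in> carrier V" "z \<in> carrier V"
  proof -
    have "x \<ominus> z = (x \<ominus> y) \<oplus> (y \<ominus> z)"
      using that by (simp add: a_minus_def M.a_assoc M.r_neg1)
    then show ?thesis using that nrm_triangle[of "x \<ominus> y" "y \<ominus> z"] by (simp add: nrm_dist_def)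
  qed
qed

lemma topspace_nrm_topology [simp]: "topspace (nrm_topology V) = carrier V"
  by (simp add: nrm_topology_def)

lemma continuous_map_nrm_topology:
  "continuous_map X (nrm_topology V) f \<longleftrightarrow>
    f \<in> topspace X \<rightarrow> carrier V \<and>
    (\<forall>x\<in>topspace X. \<forall>\<epsilon>>0. \<exists>U. openin X U \<and> x \<in> U \<and> (\<forall>y\<in>U. nrm V (f x \<ominus> f y) < \<epsilon>))"
    (is "?l \<longleftrightarrow> ?r")
proof
  assume l: ?l
  then have f: "f \<in> topspace X \<rightarrow> carrier V"
    using continuous_map_funspace[OF l] by simp
  moreover have "\<exists>U. openin X U \<and> x \<in> U \<and> (\<forall>y\<in>U. nrm V (f x \<ominus> f y) < \<epsilon>)"
    if x: "x \<in> topspace X" "\<epsilon> > 0" for x \<epsilon>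
  proof -
    obtain U where U: "openin X U" "x \<in> U" "\<forall>y\<in>U. f y \<in> metric.mball (f x) \<epsilon>"
      using l x unfolding nrm_topology_def metric.continuous_map_to_metric by blast
    then have "\<forall>y\<in>U. nrm V (f x \<ominus> f y) < \<epsilon>"
      by (simp add: nrm_dist_def cong: conj_cong)
    with U show ?thesis by blast
  qed
  ultimately show ?r by blast
next
  assume r: ?r
  show ?l
    unfolding nrm_topology_def metric.continuous_map_to_metric metric.in_mball nrm_dist_def
  proof (intro ballI allI impI)
    fix x and \<epsilon> :: real assume x: "x \<in> topspace X" "\<epsilon> > 0"
    then obtain U where U: "openin X U" "x \<in> U" "\<forall>y\<in>U. nrm V (f x \<ominus> f y) < \<epsilon>"
      using r by blast
    moreover have "f y \<in> carrier V" if "y \<in> U" for y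
      using r openin_subset[OF U(1)] that by blast
    ultimately show "\<exists>U. openin X U \<and> x \<in> U \<and> (\<forall>y\<in>U. f x \<in> carrier V \<and> f y \<in> carrier V \<and>
        (if f x \<in> carrier V \<and> f y \<in> carrier V then nrm V (f x \<ominus> f y) else 0) < \<epsilon>)"
      by auto
  qed
qed

lemma continuous_map_plus:
  assumes f: "continuous_map X (nrm_topology V) f" and g: "continuous_map X (nrm_topology V) g"
  shows "continuous_map X (nrm_topology V) (\<lambda>x. f x \<oplus> g x)"
proof -
  have fg: "f \<in> topspace X \<rightarrow> carrier V" "g \<in> topspace X \<rightarrow> carrier V"
    using f g by (simp_all add: continuous_map_nrm_topology)
  have "\<exists>U. openin X U \<and> x \<in> U \<and> (\<forall>y\<in>U. nrm V ((f x \<oplus> g x) \<ominus> (f y \<oplus> g y)) < \<epsilon>)"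
    if x: "x \<in> topspace X" and "\<epsilon> > 0" for x \<epsilon>
  proof -
    have "\<epsilon> / 2 > 0" using \<open>\<epsilon> > 0\<close> by simp
    then obtain U1 U2 where U: "openin X U1" "x \<in> U1" "\<forall>y\<in>U1. nrm V (f x \<ominus> f y) < \<epsilon> / 2"
      "openin X U2" "x \<in> U2" "\<forall>y\<in>U2. nrm V (g x \<ominus> g y) < \<epsilon> / 2"
      using f g x unfolding continuous_map_nrm_topology by metis
    have "nrm V ((f x \<oplus> g x) \<ominus> (f y \<oplus> g y)) < \<epsilon>" if "y \<in> U1 \<inter> U2" for y
    proof -
      have y: "y \<in> topspace X" using openin_subset[OF U(1)] that by blast
      have c: "f x \<in> carrier V" "f y \<in> carrier V" "g x \<in> carrier V" "g y \<in> carrier V"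
        using fg x y by auto
      have "(f x \<oplus> g x) \<ominus> (f y \<oplus> g y) = (f x \<ominus> f y) \<oplus> (g x \<ominus> g y)"
        using c by (simp add: a_minus_def M.minus_add M.a_ac)
      moreover have "nrm V (f x \<ominus> f y) < \<epsilon> / 2" "nrm V (g x \<ominus> g y) < \<epsilon> / 2"
        using U that by blast+
      ultimately show ?thesis
        using nrm_triangle[of "f x \<ominus> f y" "g x \<ominus> g y"] c by simp
    qed
    then show ?thesis using U by (intro exI[of _ "U1 \<inter> U2"]) auto
  qed
  moreover have "(\<lambda>x. f x \<oplus> g x) \<in> topspace X \<rightarrow> carrier V"
    using fg by blast
  ultimately show ?thesis unfolding continuous_map_nrm_topology by blast
qed

end

section \<open>Bounded linear operators are continuous\<close>

lemma bounded_ops_simps [simp]: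
  "carrier (bounded_ops K X Y) =
    {T. linear_op K X Y T \<and> (\<exists>C. \<forall>x\<in>carrier X. nrm Y (T x) \<le> C * nrm X x)}"
  "zero (bounded_ops K X Y) = (\<lambda>x\<in>carrier X. \<zero>\<^bsub>Y\<^esub>)"
  "add (bounded_ops K X Y) = (\<lambda>S T. \<lambda>x\<in>carrier X. S x \<oplus>\<^bsub>Y\<^esub> T x)"
  "smult (bounded_ops K X Y) = (\<lambda>a T. \<lambda>x\<in>carrier X. a \<odot>\<^bsub>Y\<^esub> T x)"
  "nrm (bounded_ops K X Y) = (\<lambda>T. SUP x\<in>{x \<in> carrier X. nrm X x \<le> 1}. nrm Y (T x))"
  by (simp_all add: bounded_ops_def)

lemma linear_opD:
  assumes "linear_op K X Y T"
  shows "x \<in> carrier X \<Longrightarrow> T x \<in> carrier Y"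
    and "x \<in> carrier X \<Longrightarrow> y \<in> carrier X \<Longrightarrow> T (x \<oplus>\<^bsub>X\<^esub> y) = T x \<oplus>\<^bsub>Y\<^esub> T y"
    and "a \<in> K \<Longrightarrow> x \<in> carrier X \<Longrightarrow> T (a \<odot>\<^bsub>X\<^esub> x) = a \<odot>\<^bsub>Y\<^esub> T x"
  using assms unfolding linear_op_def by blast+

lemma linear_op_zero:
  assumes "normed_space K X" "normed_space K Y" "linear_op K X Y T"
  shows "T \<zero>\<^bsub>X\<^esub> = \<zero>\<^bsub>Y\<^esub>"
proof -
  interpret X: normed_space K X by fact
  interpret Y: normed_space K Y by fact
  have "T (0 \<odot>\<^bsub>X\<^esub> \<zero>\<^bsub>X\<^esub>) = 0 \<odot>\<^bsub>Y\<^esub> T \<zero>\<^bsub>X\<^esub>" "T \<zero>\<^bsub>X\<^esub> \<in> carrier Y"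
    using linear_opD[OF assms(3)] X.scalars_contain by blast+
  then show ?thesis using X.smult_l_null[of "\<zero>\<^bsub>X\<^esub>"] Y.smult_l_null by simp
qed

lemma linear_op_a_inv:
  assumes "normed_space K X" "normed_space K Y" "linear_op K X Y T" "x \<in> carrier X"
  shows "T (\<ominus>\<^bsub>X\<^esub> x) = \<ominus>\<^bsub>Y\<^esub> T x"
proof -
  interpret X: normed_space K X by fact
  interpret Y: normed_space K Y by fact
  have c: "T x \<in> carrier Y" "T (\<ominus>\<^bsub>X\<^esub> x) \<in> carrier Y"
    using linear_opD(1)[OF assms(3)] assms(4) by simp_all
  have "T (\<ominus>\<^bsub>X\<^esub> x) \<oplus>\<^bsub>Y\<^esub> T x = T (\<ominus>\<^bsub>X\<^esub> x \<oplus>\<^bsub>X\<^esub> x)"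
    using linear_opD(2)[OF assms(3)] assms(4) by simp
  also have "\<dots> = \<zero>\<^bsub>Y\<^esub>"
    using linear_op_zero[OF assms(1-3)] assms(4) by (simp add: X.M.l_neg)
  finally show ?thesis using c by (metis Y.M.minus_equality)
qed

lemma bounded_op_continuous:
  assumes "normed_space K X" "normed_space K Y" "T \<in> carrier (bounded_ops K X Y)"
  shows "continuous_map (nrm_topology X) (nrm_topology Y) T"
proof -
  interpret X: normed_space K X by fact
  interpret Y: normed_space K Y by fact
  obtain C where lin: "linear_op K X Y T"
    and C: "\<And>x. x \<in> carrier X \<Longrightarrow> nrm Y (T x) \<le> C * nrm X x"
    using assms(3) by auto
  have T: "T x \<in> carrier Y" if "x \<in> carrier X" for x
    using linear_opD(1)[OF lin that] .
  \<comment> \<open>The constant \<open>C\<close> may be zero or negative; \<open>\<bar>C\<bar> + 1\<close> is a Lipschitz constant to divide by.\<close>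
  have "nrm_dist Y (T a) (T x) \<le> (\<bar>C\<bar> + 1) * nrm_dist X a x"
    if ax: "a \<in> carrier X" "x \<in> carrier X" for a x
  proof -
    have "T (a \<ominus>\<^bsub>X\<^esub> x) = T a \<ominus>\<^bsub>Y\<^esub> T x"
      using ax linear_op_a_inv[OF assms(1,2) lin ax(2)] linear_opD(2)[OF lin, of a "\<ominus>\<^bsub>X\<^esub> x"]
      by (simp add: a_minus_def)
    then have "nrm Y (T a \<ominus>\<^bsub>Y\<^esub> T x) \<le> C * nrm X (a \<ominus>\<^bsub>X\<^esub> x)"
      using C[of "a \<ominus>\<^bsub>X\<^esub> x"] ax by simp
    also have "\<dots> \<le> (\<bar>C\<bar> + 1) * nrm X (a \<ominus>\<^bsub>X\<^esub> x)"
      using ax by (intro mult_right_mono X.nrm_nonneg) auto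
    finally show ?thesis using ax T by (simp add: nrm_dist_def)
  qed
  then have "nrm_dist Y (T a) (T x) < \<epsilon>"
    if "a \<in> carrier X" "x \<in> carrier X" "nrm_dist X a x < \<epsilon> / (\<bar>C\<bar> + 1)" for a x \<epsilon>
    using that by (smt (verit) pos_less_divide_eq mult.commute)
  moreover have "\<epsilon> / (\<bar>C\<bar> + 1) > 0" if "\<epsilon> > 0" for \<epsilon> using that by (simp add: add_nonneg_pos)
  ultimately show ?thesis
    unfolding nrm_topology_def X.metric.metric_continuous_map[OF Y.metric.Metric_space_axioms]
    using T by blast
qed

lemma linear_op_preimage_submodule:
  assumes "normed_space K X" "normed_space K Y" "linear_op K X Y T" "submodule M (scalars K) Y"
  shows "submodule {x \<in> carrier X. T x \<in> M} (scalars K) X"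
proof -
  interpret X: normed_space K X by fact
  interpret Y: normed_space K Y by fact
  note M = Y.submoduleE[OF assms(4)]
  have "\<zero>\<^bsub>Y\<^esub> \<in> M"
    using subgroup.one_closed[OF submodule.axioms(1)[OF assms(4)]] by simp
  then show ?thesis
    using linear_opD[OF assms(3)] linear_op_zero[OF assms(1-3)] linear_op_a_inv[OF assms(1-3)] M(3-5)
    by (intro X.submoduleI) auto
qed

section \<open>Function spaces with a supremum norm\<close>

text \<open>
  Both \<^const>\<open>bounded_ops\<close> and \<^const>\<open>multilinear_ops\<close> consist of functions with pointwise operations,
  normed by the supremum over a set \<open>B\<close> (the unit ball). The algebraic laws and the triangle
  inequality are inherited from the values. What depends on the kind of operator is that it is
  bounded on \<open>B\<close>, so that the supremum is a genuine one, and that it is determined by its values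
  on \<open>B\<close>, so that only the zero operator has norm 0.
\<close>

lemma pointwise_sup_normed_space:
  fixes W :: "('x \<Rightarrow> 'b) normed_module" and Y :: "'b normed_module"
  assumes Y: "normed_space K Y"
    and funs: "carrier W \<subseteq> D \<rightarrow>\<^sub>E carrier Y"
    and ops: "zero W = (\<lambda>x\<in>D. \<zero>\<^bsub>Y\<^esub>)" "add W = (\<lambda>S T. \<lambda>x\<in>D. S x \<oplus>\<^bsub>Y\<^esub> T x)"
      "smult W = (\<lambda>a T. \<lambda>x\<in>D. a \<odot>\<^bsub>Y\<^esub> T x)" "nrm W = (\<lambda>T. SUP x\<in>B. nrm Y (T x))"
    and closed: "zero W \<in> carrier W"
      "\<And>S T. S \<in> carrier W \<Longrightarrow> T \<in> carrier W \<Longrightarrow> S \<oplus>\<^bsub>W\<^esub> T \<in> carrier W"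
      "\<And>a T. a \<in> K \<Longrightarrow> T \<in> carrier W \<Longrightarrow> a \<odot>\<^bsub>W\<^esub> T \<in> carrier W"
    and B: "B \<subseteq> D" "B \<noteq> {}"
    and bounded: "\<And>T. T \<in> carrier W \<Longrightarrow> \<exists>C. \<forall>x\<in>B. nrm Y (T x) \<le> C"
    and definite: "\<And>T x. T \<in> carrier W \<Longrightarrow> \<forall>x\<in>B. T x = \<zero>\<^bsub>Y\<^esub> \<Longrightarrow> x \<in> D \<Longrightarrow> T x = \<zero>\<^bsub>Y\<^esub>"
  shows "normed_space K W"
proof -
  interpret Y: normed_space K Y by fact
  have val: "T x \<in> carrier Y" if "T \<in> carrier W" "x \<in> D" for T x
    using funs that by blast
  \<comment> \<open>Members of \<open>W\<close> are extensional, so they agree once they agree on \<open>D\<close>.\<close>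
  have eqI: "S = T" if "S \<in> carrier W" "T \<in> carrier W" "\<And>x. x \<in> D \<Longrightarrow> S x = T x" for S T
    using that funs by (intro extensionalityI[of S D T]) (auto simp: PiE_def)
  have bdd: "bdd_above ((\<lambda>x. nrm Y (T x)) ` B)" if "T \<in> carrier W" for T
    using bounded[OF that] by (auto simp: bdd_above_def)
  have app: "\<zero>\<^bsub>W\<^esub> x = \<zero>\<^bsub>Y\<^esub>" "(S \<oplus>\<^bsub>W\<^esub> T) x = S x \<oplus>\<^bsub>Y\<^esub> T x" "(a \<odot>\<^bsub>W\<^esub> T) x = a \<odot>\<^bsub>Y\<^esub> T x"
    if "x \<in> D" for x S T a
    using that by (simp_all add: ops)
  have "abelian_group W"
  proof (rule abelian_groupI)
    fix S T U assume "S \<in> carrier W" "T \<in> carrier W" "U \<in> carrier W"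
    then show "S \<oplus>\<^bsub>W\<^esub> T \<oplus>\<^bsub>W\<^esub> U = S \<oplus>\<^bsub>W\<^esub> (T \<oplus>\<^bsub>W\<^esub> U)"
      by (intro eqI closed) (simp_all add: app val Y.M.a_assoc)
  next
    fix S T assume "S \<in> carrier W" "T \<in> carrier W"
    then show "S \<oplus>\<^bsub>W\<^esub> T = T \<oplus>\<^bsub>W\<^esub> S"
      by (intro eqI closed) (simp_all add: app val Y.M.a_comm)
  next
    fix T assume T: "T \<in> carrier W"
    then show "\<zero>\<^bsub>W\<^esub> \<oplus>\<^bsub>W\<^esub> T = T"
      by (intro eqI closed) (simp_all add: app val)
    have "((- 1) \<odot>\<^bsub>W\<^esub> T) \<oplus>\<^bsub>W\<^esub> T = \<zero>\<^bsub>W\<^esub>"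
      using T Y.scalars_contain(3)
      by (intro eqI closed) (simp_all add: app val Y.a_inv_eq_smult[symmetric] Y.M.l_neg)
    then show "\<exists>S\<in>carrier W. S \<oplus>\<^bsub>W\<^esub> T = \<zero>\<^bsub>W\<^esub>"
      using closed(3)[OF Y.scalars_contain(3) T] by blast
  qed (use closed in auto)
  then have "Module.module (scalars K) W"
  proof (intro moduleI)
    show "Ring.cring (scalars K)" by (rule Y.R.is_cring)
  next
    fix a b T assume "a \<in> carrier (scalars K)" "b \<in> carrier (scalars K)" "T \<in> carrier W"
    moreover from this have "a + b \<in> K" "a * b \<in> K"
      using Y.R.a_closed[of a b] Y.R.m_closed[of a b] by simp_all
    ultimately show "(a \<oplus>\<^bsub>scalars K\<^esub> b) \<odot>\<^bsub>W\<^esub> T = a \<odot>\<^bsub>W\<^esub> T \<oplus>\<^bsub>W\<^esub> b \<odot>\<^bsub>W\<^esub> T"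
      "a \<otimes>\<^bsub>scalars K\<^esub> b \<odot>\<^bsub>W\<^esub> T = a \<odot>\<^bsub>W\<^esub> (b \<odot>\<^bsub>W\<^esub> T)"
      using Y.smult_l_distr[of a b] Y.smult_assoc1[of a b]
      by (auto intro!: eqI closed simp: app val)
  next
    fix a S T assume "a \<in> carrier (scalars K)" "S \<in> carrier W" "T \<in> carrier W"
    then show "a \<odot>\<^bsub>W\<^esub> (S \<oplus>\<^bsub>W\<^esub> T) = a \<odot>\<^bsub>W\<^esub> S \<oplus>\<^bsub>W\<^esub> a \<odot>\<^bsub>W\<^esub> T"
      using Y.smult_r_distr[of a] by (auto intro!: eqI closed simp: app val)
  next
    fix T assume "T \<in> carrier W"
    then show "\<one>\<^bsub>scalars K\<^esub> \<odot>\<^bsub>W\<^esub> T = T"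
      using Y.scalars_contain Y.smult_one by (auto intro!: eqI closed simp: app val)
  qed (use closed in auto)
  then show ?thesis
  proof (intro normed_space.intro normed_space_axioms.intro)
    obtain b where b: "b \<in> B" using B by blast
    have upper: "nrm Y (T x) \<le> nrm W T" if "T \<in> carrier W" "x \<in> B" for T x
      unfolding ops by (rule cSUP_upper[OF that(2) bdd[OF that(1)]])
    have least: "nrm W T \<le> c" if "\<And>x. x \<in> B \<Longrightarrow> nrm Y (T x) \<le> c" for T c
      unfolding ops using that B by (intro cSUP_least)
    have ge0: "0 \<le> nrm W T" if "T \<in> carrier W" for T
      using upper[OF that b] Y.nrm_nonneg[OF val[OF that, of b]] B b by fastforce
    {
      fix T assume T: "T \<in> carrier W"
      show "0 \<le> nrm W T" by (rule ge0[OF T])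
      show "nrm W T = 0 \<longleftrightarrow> T = \<zero>\<^bsub>W\<^esub>"
      proof
        assume "nrm W T = 0"
        then have "\<forall>x\<in>B. T x = \<zero>\<^bsub>Y\<^esub>"
          using upper[OF T] val[OF T] B Y.nrm_eq_0_iff Y.nrm_nonneg by (metis order_antisym subsetD)
        then show "T = \<zero>\<^bsub>W\<^esub>"
          using definite[OF T] T closed(1) by (auto intro!: eqI simp: app)
      next
        assume "T = \<zero>\<^bsub>W\<^esub>"
        then have "nrm W T \<le> 0" using B by (intro least) (auto simp: app)
        then show "nrm W T = 0" using ge0[OF T] by simp
      qed
    next
      fix a T assume a: "a \<in> K" and T: "T \<in> carrier W"
      have eq: "nrm Y ((a \<odot>\<^bsub>W\<^esub> T) x) = cmod a * nrm Y (T x)" if "x \<in> B" for x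
        using that B a T Y.nrm_smult[OF a val[OF T]] by (auto simp: app)
      show "nrm W (a \<odot>\<^bsub>W\<^esub> T) = cmod a * nrm W T"
      proof (rule order_antisym)
        show "nrm W (a \<odot>\<^bsub>W\<^esub> T) \<le> cmod a * nrm W T"
          by (intro least) (simp add: eq mult_left_mono upper T)
        show "cmod a * nrm W T \<le> nrm W (a \<odot>\<^bsub>W\<^esub> T)"
        proof (cases "a = 0")
          case True
          then show ?thesis using ge0[OF closed(3)[OF a T]] by simp
        next
          case False
          have "nrm W T \<le> nrm W (a \<odot>\<^bsub>W\<^esub> T) / cmod a"
            using upper[OF closed(3)[OF a T]] False
            by (intro least) (simp add: eq field_simps)
          then show ?thesis using False by (simp add: field_simps)
        qed
      qed
    next
      fix S T assume ST: "S \<in> carrier W" "T \<in> carrier W"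
      show "nrm W (S \<oplus>\<^bsub>W\<^esub> T) \<le> nrm W S + nrm W T"
      proof (intro least)
        fix x assume x: "x \<in> B"
        then have "nrm Y ((S \<oplus>\<^bsub>W\<^esub> T) x) \<le> nrm Y (S x) + nrm Y (T x)"
          using Y.nrm_triangle[OF val[OF ST(1)] val[OF ST(2)]] B by (auto simp: app)
        then show "nrm Y ((S \<oplus>\<^bsub>W\<^esub> T) x) \<le> nrm W S + nrm W T"
          using upper[OF ST(1) x] upper[OF ST(2) x] by linarith
      qed
    }
  qed
qed

section \<open>The normed space of bounded linear operators\<close>

lemma of_real_in_scalars: "K = \<real> \<or> K = UNIV \<Longrightarrow> complex_of_real r \<in> K"
  by auto

text \<open>
  Positive real scaling moves any vector into a given ball around zero; this is how statements
  about operators on a ball are carried over to the whole space.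
\<close>

lemma (in normed_space) scale_into_ball:
  assumes K: "K = \<real> \<or> K = UNIV" and "0 < \<delta>" and x: "x \<in> carrier V"
  obtains t :: real where "t > 0" "nrm V (complex_of_real t \<odot> x) < \<delta>"
proof
  have n: "nrm V x \<ge> 0" by (rule nrm_nonneg[OF x])
  \<comment> \<open>The summand 1 lets the same factor serve for \<open>x = \<zero>\<close> and keeps the inequality strict.\<close>
  show "\<delta> / (1 + nrm V x) > 0" using assms n by (simp add: add_pos_nonneg)
  have "\<delta> / (1 + nrm V x) * nrm V x < \<delta>"
    using n \<open>0 < \<delta>\<close> by (simp add: field_simps)
  then show "nrm V (complex_of_real (\<delta> / (1 + nrm V x)) \<odot> x) < \<delta>"
    using nrm_smult[OF of_real_in_scalars[OF K] x, of "\<delta> / (1 + nrm V x)"] n \<open>0 < \<delta>\<close>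
    by (simp add: norm_divide add_nonneg_nonneg del: of_real_divide of_real_add)
qed

lemma (in normed_space) smult_eq_zeroD:
  assumes "a \<in> K" "a \<noteq> 0" "x \<in> carrier V" "a \<odot> x = \<zero>"
  shows "x = \<zero>"
  using nrm_smult[of a x] assms nrm_eq_0_iff[of x] nrm_zero by simp

lemma bounded_op_bounded_on_ball:
  assumes X: "normed_space K X" and T: "T \<in> carrier (bounded_ops K X Y)"
  shows "\<exists>C. \<forall>x\<in>{x \<in> carrier X. nrm X x \<le> 1}. nrm Y (T x) \<le> C"
proof -
  from T obtain C where C: "\<And>x. x \<in> carrier X \<Longrightarrow> nrm Y (T x) \<le> C * nrm X x"
    by auto
  have "nrm Y (T x) \<le> \<bar>C\<bar>" if "x \<in> carrier X" "nrm X x \<le> 1" for x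
  proof -
    have "C * nrm X x \<le> \<bar>C\<bar> * nrm X x"
      using normed_space.nrm_nonneg[OF X that(1)] by (intro mult_right_mono) auto
    also have "\<dots> \<le> \<bar>C\<bar> * 1" using that by (intro mult_left_mono) auto
    finally show ?thesis using C[OF that(1)] by simp
  qed
  then show ?thesis by auto
qed

lemma bounded_op_bound:
  assumes K: "K = \<real> \<or> K = UNIV" and X: "normed_space K X" and Y: "normed_space K Y"
    and T: "T \<in> carrier (bounded_ops K X Y)" and x: "x \<in> carrier X"
  shows "nrm Y (T x) \<le> nrm (bounded_ops K X Y) T * nrm X x"
proof -
  interpret X: normed_space K X by fact
  interpret Y: normed_space K Y by fact
  have lin: "linear_op K X Y T" using T by simp
  show ?thesis
  proof (cases "x = \<zero>\<^bsub>X\<^esub>")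
    case True
    then show ?thesis using linear_op_zero[OF X Y lin] by simp
  next
    case False
    then have n: "nrm X x > 0" using X.nrm_nonneg[OF x] X.nrm_eq_0_iff[OF x] by simp
    let ?a = "complex_of_real (inverse (nrm X x))"
    have a: "?a \<in> K" by (rule of_real_in_scalars[OF K])
    have ca: "cmod ?a = inverse (nrm X x)" using n by (simp add: norm_inverse)
    have ball: "?a \<odot>\<^bsub>X\<^esub> x \<in> {x \<in> carrier X. nrm X x \<le> 1}"
      using X.nrm_smult[OF a x] X.smult_closed[of ?a x] a x n by (simp add: ca del: of_real_inverse)
    have bdd: "bdd_above ((\<lambda>x. nrm Y (T x)) ` {x \<in> carrier X. nrm X x \<le> 1})"
      using bounded_op_bounded_on_ball[OF X T] by (auto simp: bdd_above_def)
    have "nrm Y (T (?a \<odot>\<^bsub>X\<^esub> x)) \<le> nrm (bounded_ops K X Y) T"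
      using cSUP_upper[OF ball bdd] by simp
    moreover have "nrm Y (T (?a \<odot>\<^bsub>X\<^esub> x)) = inverse (nrm X x) * nrm Y (T x)"
      using linear_opD(3)[OF lin a x] Y.nrm_smult[OF a linear_opD(1)[OF lin x]] by (simp only: ca)
    ultimately have "inverse (nrm X x) * nrm Y (T x) \<le> nrm (bounded_ops K X Y) T" by (simp only:)
    then show ?thesis using n by (simp add: field_simps)
  qed
qed

lemma bounded_ops_normed_space:
  assumes K: "K = \<real> \<or> K = UNIV" and X: "normed_space K X" and Y: "normed_space K Y"
  shows "normed_space K (bounded_ops K X Y)"
proof -
  interpret X: normed_space K X by fact
  interpret Y: normed_space K Y by fact
  show ?thesis
  proof (rule pointwise_sup_normed_space[OF Y, where D = "carrier X" and B = "{x \<in> carrier X. nrm X x \<le> 1}"])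
    show "carrier (bounded_ops K X Y) \<subseteq> carrier X \<rightarrow>\<^sub>E carrier Y"
      by (auto simp only: bounded_ops_simps linear_op_def)
    have "linear_op K X Y (\<lambda>x\<in>carrier X. \<zero>\<^bsub>Y\<^esub>)"
      unfolding linear_op_def using Y.smult_r_null by auto
    then show "\<zero>\<^bsub>bounded_ops K X Y\<^esub> \<in> carrier (bounded_ops K X Y)"
      by (auto intro!: exI[of _ 0])
    show "S \<oplus>\<^bsub>bounded_ops K X Y\<^esub> T \<in> carrier (bounded_ops K X Y)"
      if S: "S \<in> carrier (bounded_ops K X Y)" and T: "T \<in> carrier (bounded_ops K X Y)" for S T
    proof -
      from S T obtain C D where lin: "linear_op K X Y S" "linear_op K X Y T"
        and C: "\<And>x. x \<in> carrier X \<Longrightarrow> nrm Y (S x) \<le> C * nrm X x"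
        and D: "\<And>x. x \<in> carrier X \<Longrightarrow> nrm Y (T x) \<le> D * nrm X x"
        by auto
      note S = linear_opD[OF lin(1)] and T = linear_opD[OF lin(2)]
      have "linear_op K X Y (\<lambda>x\<in>carrier X. S x \<oplus>\<^bsub>Y\<^esub> T x)"
        unfolding linear_op_def using S T Y.smult_r_distr by (auto simp: Y.M.a_ac)
      moreover have "nrm Y (S x \<oplus>\<^bsub>Y\<^esub> T x) \<le> (C + D) * nrm X x" if "x \<in> carrier X" for x
        using Y.nrm_triangle[OF S(1) T(1)] C D that by (fastforce simp: distrib_right)
      ultimately show ?thesis by auto
    qed
    show "a \<odot>\<^bsub>bounded_ops K X Y\<^esub> T \<in> carrier (bounded_ops K X Y)"
      if a: "a \<in> K" and T: "T \<in> carrier (bounded_ops K X Y)" for a T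
    proof -
      from T obtain C where lin: "linear_op K X Y T"
        and C: "\<And>x. x \<in> carrier X \<Longrightarrow> nrm Y (T x) \<le> C * nrm X x"
        by auto
      note T = linear_opD[OF lin]
      have "linear_op K X Y (\<lambda>x\<in>carrier X. a \<odot>\<^bsub>Y\<^esub> T x)"
        unfolding linear_op_def
        using a T Y.smult_r_distr Y.smult_assoc1[symmetric] by (auto simp: mult.commute)
      moreover have "nrm Y (a \<odot>\<^bsub>Y\<^esub> T x) \<le> (cmod a * C) * nrm X x" if "x \<in> carrier X" for x
        using Y.nrm_smult[OF a T(1)[OF that]] C[OF that] by (simp add: mult.assoc mult_left_mono)
      ultimately show ?thesis by auto
    qed
    show "{x \<in> carrier X. nrm X x \<le> 1} \<noteq> {}"
      using X.M.zero_closed X.nrm_zero by fastforce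
    show "\<exists>C. \<forall>x\<in>{x \<in> carrier X. nrm X x \<le> 1}. nrm Y (T x) \<le> C"
      if "T \<in> carrier (bounded_ops K X Y)" for T
      by (rule bounded_op_bounded_on_ball[OF X that])
    show "T x = \<zero>\<^bsub>Y\<^esub>"
      if T: "T \<in> carrier (bounded_ops K X Y)" and zero: "\<forall>x\<in>{x \<in> carrier X. nrm X x \<le> 1}. T x = \<zero>\<^bsub>Y\<^esub>"
        and x: "x \<in> carrier X" for T x
    proof -
      have lin: "linear_op K X Y T" using T by simp
      obtain t where t: "t > 0" "nrm X (complex_of_real t \<odot>\<^bsub>X\<^esub> x) < 1"
        using X.scale_into_ball[OF K zero_less_one x] .
      have tK: "complex_of_real t \<in> K" by (rule of_real_in_scalars[OF K])
      have "complex_of_real t \<odot>\<^bsub>Y\<^esub> T x = \<zero>\<^bsub>Y\<^esub>"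
        using linear_opD(3)[OF lin tK x] zero t X.smult_closed[of "complex_of_real t" x] tK x by simp
      then show ?thesis
        using Y.smult_eq_zeroD[OF tK _ linear_opD(1)[OF lin x]] t by simp
    qed
  qed auto
qed

section \<open>The normed space of continuous multilinear operators\<close>

lemma multilinear_ops_simps [simp]:
  "carrier (multilinear_ops K m E F) = {A. multilinear_op K m E F A \<and>
    continuous_map (product_topology (\<lambda>i. nrm_topology (E i)) {1..m}) (nrm_topology F) A}"
  "zero (multilinear_ops K m E F) = (\<lambda>x\<in>prod_carrier m E. \<zero>\<^bsub>F\<^esub>)"
  "add (multilinear_ops K m E F) = (\<lambda>A B. \<lambda>x\<in>prod_carrier m E. A x \<oplus>\<^bsub>F\<^esub> B x)"
  "smult (multilinear_ops K m E F) = (\<lambda>a A. \<lambda>x\<in>prod_carrier m E. a \<odot>\<^bsub>F\<^esub> A x)"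
  "nrm (multilinear_ops K m E F) =
    (\<lambda>A. SUP x\<in>{x \<in> prod_carrier m E. \<forall>i\<in>{1..m}. nrm (E i) (x i) \<le> 1}. nrm F (A x))"
  by (simp_all add: multilinear_ops_def)

lemma prod_carrier_upd:
  assumes "x \<in> prod_carrier m E" "i \<in> {1..m}" "u \<in> carrier (E i)"
  shows "x(i := u) \<in> prod_carrier m E"
  using assms by (auto simp: prod_carrier_def PiE_iff extensional_def)

lemma multilinear_opD:
  assumes "multilinear_op K m E F A"
  shows "x \<in> prod_carrier m E \<Longrightarrow> A x \<in> carrier F"
    and "x \<in> prod_carrier m E \<Longrightarrow> i \<in> {1..m} \<Longrightarrow> u \<in> carrier (E i) \<Longrightarrow> v \<in> carrier (E i) \<Longrightarrow>
      A (x(i := u \<oplus>\<^bsub>E i\<^esub> v)) = A (x(i := u)) \<oplus>\<^bsub>F\<^esub> A (x(i := v))"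
    and "x \<in> prod_carrier m E \<Longrightarrow> i \<in> {1..m} \<Longrightarrow> a \<in> K \<Longrightarrow> u \<in> carrier (E i) \<Longrightarrow>
      A (x(i := a \<odot>\<^bsub>E i\<^esub> u)) = a \<odot>\<^bsub>F\<^esub> A (x(i := u))"
  using assms unfolding multilinear_op_def by blast+

locale normed_family =
  fixes K :: "complex set" and m :: nat and E :: "nat \<Rightarrow> 'a normed_module"
  assumes scalar_field: "K = \<real> \<or> K = UNIV"
    and normed: "\<And>i. i \<in> {1..m} \<Longrightarrow> normed_space K (E i)"
begin

abbreviation unit_ball :: "(nat \<Rightarrow> 'a) set" where
  "unit_ball \<equiv> {x \<in> prod_carrier m E. \<forall>i\<in>{1..m}. nrm (E i) (x i) \<le> 1}"

text \<open>
  Only the coordinates in \<open>S\<close> are rescaled, because homogeneity in each variable pulls the factors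
  out of a multilinear operator one coordinate at a time, by induction on \<open>S\<close>.
\<close>

definition scale :: "(nat \<Rightarrow> real) \<Rightarrow> nat set \<Rightarrow> (nat \<Rightarrow> 'a) \<Rightarrow> nat \<Rightarrow> 'a" where
  "scale t S x = (\<lambda>i. if i \<in> S then complex_of_real (t i) \<odot>\<^bsub>E i\<^esub> x i else x i)"

lemma carrier_module_closed:
  assumes "i \<in> {1..m}"
  shows "\<zero>\<^bsub>E i\<^esub> \<in> carrier (E i)"
    and "u \<in> carrier (E i) \<Longrightarrow> v \<in> carrier (E i) \<Longrightarrow> u \<oplus>\<^bsub>E i\<^esub> v \<in> carrier (E i)"
    and "a \<in> K \<Longrightarrow> u \<in> carrier (E i) \<Longrightarrow> a \<odot>\<^bsub>E i\<^esub> u \<in> carrier (E i)"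
proof -
  interpret normed_space K "E i" using normed[OF assms] .
  show "\<zero>\<^bsub>E i\<^esub> \<in> carrier (E i)" "u \<in> carrier (E i) \<Longrightarrow> v \<in> carrier (E i) \<Longrightarrow> u \<oplus>\<^bsub>E i\<^esub> v \<in> carrier (E i)"
    "a \<in> K \<Longrightarrow> u \<in> carrier (E i) \<Longrightarrow> a \<odot>\<^bsub>E i\<^esub> u \<in> carrier (E i)"
    by simp_all
qed

lemma scale_in_prod_carrier:
  assumes "x \<in> prod_carrier m E" "S \<subseteq> {1..m}"
  shows "scale t S x \<in> prod_carrier m E"
  using assms carrier_module_closed(3) of_real_in_scalars[OF scalar_field]
  by (auto simp: scale_def prod_carrier_def PiE_iff extensional_def)

lemma multilinear_op_scale:
  assumes F: "normed_space K F" and A: "multilinear_op K m E F A"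
    and x: "x \<in> prod_carrier m E" and S: "S \<subseteq> {1..m}"
  shows "A (scale t S x) = complex_of_real (\<Prod>i\<in>S. t i) \<odot>\<^bsub>F\<^esub> A x"
proof -
  interpret F: normed_space K F by fact
  have Ax: "A x \<in> carrier F" by (rule multilinear_opD(1)[OF A x])
  have "finite S" using S finite_subset by blast
  then show ?thesis using S
  proof (induction S rule: finite_induct)
    case empty
    then show ?case using F.smult_one[OF Ax] by (simp add: scale_def)
  next
    case (insert j S)
    have j: "j \<in> {1..m}" "x j \<in> carrier (E j)"
      using insert.prems x by (auto simp: prod_carrier_def)
    have y: "scale t S x \<in> prod_carrier m E"
      using insert.prems x by (intro scale_in_prod_carrier) auto
    have "scale t (insert j S) x = (scale t S x)(j := complex_of_real (t j) \<odot>\<^bsub>E j\<^esub> x j)"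
      by (auto simp: scale_def)
    moreover have "(scale t S x)(j := x j) = scale t S x"
      using insert.hyps by (auto simp: scale_def)
    ultimately have "A (scale t (insert j S) x) = complex_of_real (t j) \<odot>\<^bsub>F\<^esub> A (scale t S x)"
      using multilinear_opD(3)[OF A y j(1) of_real_in_scalars[OF scalar_field] j(2)] by simp
    also have "\<dots> = complex_of_real (t j) \<odot>\<^bsub>F\<^esub> (complex_of_real (\<Prod>i\<in>S. t i) \<odot>\<^bsub>F\<^esub> A x)"
      using insert by simp
    also have "\<dots> = (complex_of_real (t j) * complex_of_real (\<Prod>i\<in>S. t i)) \<odot>\<^bsub>F\<^esub> A x"
      using F.smult_assoc1[of "complex_of_real (t j)" "complex_of_real (\<Prod>i\<in>S. t i)" "A x"]
        Ax of_real_in_scalars[OF scalar_field] by (simp only: scalars_simps)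
    also have "complex_of_real (t j) * complex_of_real (\<Prod>i\<in>S. t i) = complex_of_real (\<Prod>i\<in>insert j S. t i)"
      using insert.hyps by simp
    finally show ?case .
  qed
qed

lemma origin_in_unit_ball: "(\<lambda>i\<in>{1..m}. \<zero>\<^bsub>E i\<^esub>) \<in> unit_ball"
  using carrier_module_closed(1) normed_space.nrm_zero[OF normed]
  by (auto simp: prod_carrier_def)

lemma topspace_prod:
  "topspace (product_topology (\<lambda>i. nrm_topology (E i)) {1..m}) = prod_carrier m E"
  unfolding prod_carrier_def topspace_product_topology
  by (intro PiE_cong) (simp add: normed_space.topspace_nrm_topology[OF normed])

lemma continuous_map_restrict_prod_carrier:
  assumes "continuous_map (product_topology (\<lambda>i. nrm_topology (E i)) {1..m}) T f"
  shows "continuous_map (product_topology (\<lambda>i. nrm_topology (E i)) {1..m}) T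
    (restrict f (prod_carrier m E))"
  by (rule continuous_map_eq[OF assms]) (simp only: topspace_prod restrict_apply if_True)

text \<open>
  Continuity at the origin gives a product of balls of radii \<open>\<delta> i\<close> on which \<open>A\<close> stays within
  distance 1 of its value at the origin. Rescaling the coordinates by \<open>t i = \<delta> i / 2\<close> maps the unit
  ball into that product and multiplies the values of \<open>A\<close> by the product of the \<open>t i\<close>, which is a
  fixed positive number; dividing by it bounds \<open>A\<close> on the unit ball.
\<close>

lemma multilinear_op_bounded_on_ball:
  assumes F: "normed_space K F" and A: "A \<in> carrier (multilinear_ops K m E F)"
  shows "\<exists>C. \<forall>x\<in>unit_ball. nrm F (A x) \<le> C"
proof -
  interpret F: normed_space K F by fact
  let ?P = "product_topology (\<lambda>i. nrm_topology (E i)) {1..m}"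
  define z where "z = (\<lambda>i\<in>{1..m}. \<zero>\<^bsub>E i\<^esub>)"
  have z: "z \<in> prod_carrier m E" using origin_in_unit_ball unfolding z_def by blast
  have ml: "multilinear_op K m E F A" and cont: "continuous_map ?P (nrm_topology F) A"
    using A by simp_all
  note Ac = multilinear_opD(1)[OF ml]
  obtain U where U: "openin ?P U" "z \<in> U" "\<forall>y\<in>U. nrm F (A z \<ominus>\<^bsub>F\<^esub> A y) < 1"
    using cont z zero_less_one unfolding F.continuous_map_nrm_topology topspace_prod by metis
  obtain W where W: "z \<in> (\<Pi>\<^sub>E i\<in>{1..m}. W i)" "\<forall>i. openin (nrm_topology (E i)) (W i)"
      "(\<Pi>\<^sub>E i\<in>{1..m}. W i) \<subseteq> U"
    using product_topology_open_contains_basis[OF U(1,2)] by blast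
  have "\<exists>\<delta>>0. \<forall>u\<in>carrier (E i). nrm (E i) u < \<delta> \<longrightarrow> u \<in> W i" if i: "i \<in> {1..m}" for i
  proof -
    interpret E: normed_space K "E i" using normed[OF i] .
    have "\<zero>\<^bsub>E i\<^esub> \<in> W i" using W(1) i by (auto simp: z_def PiE_iff)
    then obtain \<delta> where "\<delta> > 0" "E.metric.mball \<zero>\<^bsub>E i\<^esub> \<delta> \<subseteq> W i"
      using W(2)[rule_format, of i] unfolding nrm_topology_def E.metric.openin_mtopology by blast
    then show ?thesis
      by (intro exI[of _ \<delta>])
        (auto simp: subset_iff nrm_dist_def E.nrm_a_inv a_minus_def)
  qed
  then obtain \<delta> where \<delta>: "\<And>i. i \<in> {1..m} \<Longrightarrow> \<delta> i > 0"
      "\<And>i u. i \<in> {1..m} \<Longrightarrow> u \<in> carrier (E i) \<Longrightarrow> nrm (E i) u < \<delta> i \<Longrightarrow> u \<in> W i"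
    by metis
  define t where "t i = \<delta> i / 2" for i
  define p where "p = (\<Prod>i\<in>{1..m}. t i)"
  have p: "p > 0" unfolding p_def t_def using \<delta>(1) by (intro prod_pos) simp
  have "nrm F (A x) \<le> (1 + nrm F (A z)) / p" if x: "x \<in> unit_ball" for x
  proof -
    have xc: "x \<in> prod_carrier m E" using x by simp
    have y: "scale t {1..m} x \<in> prod_carrier m E" by (rule scale_in_prod_carrier[OF xc]) simp
    have "scale t {1..m} x i \<in> W i" if i: "i \<in> {1..m}" for i
    proof (rule \<delta>(2)[OF i])
      interpret E: normed_space K "E i" using normed[OF i] .
      have xi: "x i \<in> carrier (E i)" using xc i by (auto simp: prod_carrier_def)
      show "scale t {1..m} x i \<in> carrier (E i)" using y i by (auto simp: prod_carrier_def)
      have "nrm (E i) (scale t {1..m} x i) = t i * nrm (E i) (x i)"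
        using i \<delta>(1)[OF i] E.nrm_smult[OF of_real_in_scalars[OF scalar_field] xi, of "t i"]
        by (simp add: scale_def t_def)
      also have "\<dots> \<le> t i * 1"
        using x i \<delta>(1)[OF i] by (intro mult_left_mono) (auto simp: t_def)
      also have "\<dots> < \<delta> i" using \<delta>(1)[OF i] by (simp add: t_def)
      finally show "nrm (E i) (scale t {1..m} x i) < \<delta> i" .
    qed
    then have "scale t {1..m} x \<in> (\<Pi>\<^sub>E i\<in>{1..m}. W i)"
      using y by (simp add: prod_carrier_def PiE_iff)
    then have "scale t {1..m} x \<in> U"
      using W(3) by blast
    then have less: "nrm F (A z \<ominus>\<^bsub>F\<^esub> A (scale t {1..m} x)) < 1"
      using U(3) by blast
    let ?b = "A z" and ?c = "A (scale t {1..m} x)"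
    have bc: "?b \<in> carrier F" "?c \<in> carrier F" using Ac z y by simp_all
    have "\<ominus>\<^bsub>F\<^esub> ?c = (?b \<ominus>\<^bsub>F\<^esub> ?c) \<oplus>\<^bsub>F\<^esub> (\<ominus>\<^bsub>F\<^esub> ?b)"
      using bc by (simp add: a_minus_def F.M.a_ac F.M.r_neg1 F.M.r_neg2)
    then have "nrm F ?c \<le> nrm F (?b \<ominus>\<^bsub>F\<^esub> ?c) + nrm F ?b"
      using F.nrm_triangle[of "?b \<ominus>\<^bsub>F\<^esub> ?c" "\<ominus>\<^bsub>F\<^esub> ?b"] bc F.nrm_a_inv[of ?b] F.nrm_a_inv[of ?c] by simp
    moreover have "?c = complex_of_real p \<odot>\<^bsub>F\<^esub> A x"
      unfolding p_def by (rule multilinear_op_scale[OF F ml xc order_refl])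
    then have "nrm F ?c = p * nrm F (A x)"
      using F.nrm_smult[OF of_real_in_scalars[OF scalar_field] Ac[OF xc], of p] p by simp
    ultimately show ?thesis using less p by (simp add: field_simps)
  qed
  then show ?thesis by blast
qed

text \<open>
  Every point of the product can be rescaled, coordinate by coordinate, into the unit ball, and this
  changes the value of \<open>A\<close> only by a nonzero factor.
\<close>

lemma multilinear_op_zero_on_ball:
  assumes F: "normed_space K F" and A: "multilinear_op K m E F A"
    and zero: "\<forall>x\<in>unit_ball. A x = \<zero>\<^bsub>F\<^esub>" and x: "x \<in> prod_carrier m E"
  shows "A x = \<zero>\<^bsub>F\<^esub>"
proof -
  interpret F: normed_space K F by fact
  have "\<exists>t>0. nrm (E i) (complex_of_real t \<odot>\<^bsub>E i\<^esub> x i) < 1"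
    if i: "i \<in> {1..m}" for i
  proof -
    have "x i \<in> carrier (E i)" using x i by (auto simp: prod_carrier_def)
    from normed_space.scale_into_ball[OF normed[OF i] scalar_field zero_less_one this]
    show ?thesis by blast
  qed
  then obtain t where t: "\<And>i. i \<in> {1..m} \<Longrightarrow> t i > 0"
      "\<And>i. i \<in> {1..m} \<Longrightarrow> nrm (E i) (complex_of_real (t i) \<odot>\<^bsub>E i\<^esub> x i) < 1"
    by metis
  have "scale t {1..m} x \<in> unit_ball"
    using scale_in_prod_carrier[OF x order_refl] t(2) by (auto simp: scale_def less_imp_le)
  then have "complex_of_real (\<Prod>i\<in>{1..m}. t i) \<odot>\<^bsub>F\<^esub> A x = \<zero>\<^bsub>F\<^esub>"
    using multilinear_op_scale[OF F A x order_refl, of t] zero by simp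
  moreover have "(\<Prod>i\<in>{1..m}. t i) > 0" using t(1) by (intro prod_pos) simp
  ultimately show ?thesis
    using F.smult_eq_zeroD[OF of_real_in_scalars[OF scalar_field] _ multilinear_opD(1)[OF A x]]
    by (metis of_real_eq_0_iff less_irrefl)
qed

text \<open>
  For a functional \<open>T\<close> the composite is the value of the adjoint of \<open>A\<close> at \<open>T\<close>; for multiplication by
  a scalar it is the scalar multiple of \<open>A\<close>.
\<close>

lemma bounded_op_comp_multilinear:
  assumes X: "normed_space K X" and Y: "normed_space K Y"
    and T: "T \<in> carrier (bounded_ops K X Y)" and A: "A \<in> carrier (multilinear_ops K m E X)"
  shows "(\<lambda>x\<in>prod_carrier m E. T (A x)) \<in> carrier (multilinear_ops K m E Y)"
proof -
  have lin: "linear_op K X Y T" and ml: "multilinear_op K m E X A" using T A by simp_all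
  note A' = multilinear_opD[OF ml]
  have "multilinear_op K m E Y (\<lambda>x\<in>prod_carrier m E. T (A x))"
    unfolding multilinear_op_def
    using linear_opD[OF lin] A' prod_carrier_upd[of _ m E] carrier_module_closed
    by (auto simp del: fun_upd_apply)
  moreover have "continuous_map (product_topology (\<lambda>i. nrm_topology (E i)) {1..m})
      (nrm_topology Y) (\<lambda>x\<in>prod_carrier m E. T (A x))"
  proof (rule continuous_map_restrict_prod_carrier)
    have "continuous_map (product_topology (\<lambda>i. nrm_topology (E i)) {1..m}) (nrm_topology X) A"
      using A by simp
    from continuous_map_compose[OF this bounded_op_continuous[OF X Y T]]
    show "continuous_map (product_topology (\<lambda>i. nrm_topology (E i)) {1..m}) (nrm_topology Y) (\<lambda>x. T (A x))"
      unfolding o_def .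
  qed
  ultimately show ?thesis by simp
qed

lemma multilinear_ops_normed_space:
  assumes F: "normed_space K F"
  shows "normed_space K (multilinear_ops K m E F)"
proof -
  interpret F: normed_space K F by fact
  let ?P = "product_topology (\<lambda>i. nrm_topology (E i)) {1..m}"
  let ?W = "multilinear_ops K m E F"
  show ?thesis
  proof (rule pointwise_sup_normed_space[OF F, where D = "prod_carrier m E" and B = unit_ball])
    show "carrier ?W \<subseteq> prod_carrier m E \<rightarrow>\<^sub>E carrier F"
      by (auto simp only: multilinear_ops_simps multilinear_op_def)
    have "multilinear_op K m E F (\<lambda>x\<in>prod_carrier m E. \<zero>\<^bsub>F\<^esub>)"
      unfolding multilinear_op_def
      using prod_carrier_upd[of _ m E] carrier_module_closed F.smult_r_null by auto
    moreover have "continuous_map ?P (nrm_topology F) (\<lambda>x\<in>prod_carrier m E. \<zero>\<^bsub>F\<^esub>)"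
      by (intro continuous_map_restrict_prod_carrier) simp
    ultimately show "\<zero>\<^bsub>?W\<^esub> \<in> carrier ?W" by simp
    show "A \<oplus>\<^bsub>?W\<^esub> B \<in> carrier ?W" if A: "A \<in> carrier ?W" and B: "B \<in> carrier ?W" for A B
    proof -
      note ml = multilinear_opD[of K m E F A] multilinear_opD[of K m E F B]
      have "multilinear_op K m E F (\<lambda>x\<in>prod_carrier m E. A x \<oplus>\<^bsub>F\<^esub> B x)"
        unfolding multilinear_op_def
        using A B ml prod_carrier_upd[of _ m E] carrier_module_closed F.smult_r_distr
        by (auto simp: F.M.a_ac simp del: fun_upd_apply)
      moreover have "continuous_map ?P (nrm_topology F) (\<lambda>x\<in>prod_carrier m E. A x \<oplus>\<^bsub>F\<^esub> B x)"
        using A B by (intro continuous_map_restrict_prod_carrier F.continuous_map_plus) simp_all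
      ultimately show ?thesis by simp
    qed
    show "a \<odot>\<^bsub>?W\<^esub> A \<in> carrier ?W" if a: "a \<in> K" and A: "A \<in> carrier ?W" for a A
    proof -
      have "(\<lambda>y\<in>carrier F. a \<odot>\<^bsub>F\<^esub> y) \<in> carrier (bounded_ops K F F)"
        using a F.smult_r_distr F.smult_assoc1[symmetric] F.nrm_smult
        by (auto simp: linear_op_def mult.commute intro!: exI[of _ "cmod a"])
      from bounded_op_comp_multilinear[OF F F this A] show ?thesis
        using A multilinear_opD(1)[of K m E F A] by (simp cong: restrict_cong)
    qed
    show "unit_ball \<noteq> {}" using origin_in_unit_ball by blast
    show "A x = \<zero>\<^bsub>F\<^esub>"
      if "A \<in> carrier ?W" "\<forall>x\<in>unit_ball. A x = \<zero>\<^bsub>F\<^esub>" "x \<in> prod_carrier m E" for A x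
      using multilinear_op_zero_on_ball[OF F] that by simp
    show "\<exists>C. \<forall>x\<in>unit_ball. nrm F (A x) \<le> C" if "A \<in> carrier ?W" for A
      by (rule multilinear_op_bounded_on_ball[OF F that])
  qed auto
qed

end

section \<open>Passing to the adjoint\<close>

text \<open>
  The estimate \<open>\<bar>\<phi> (A x)\<bar> \<le> \<parallel>\<phi>\<parallel> \<parallel>A x\<parallel> \<le> \<parallel>\<phi>\<parallel> \<parallel>A\<parallel>\<close> on the unit ball is used twice: for fixed \<open>A\<close> it shows
  that the adjoint of \<open>A\<close> is bounded, and taking the supremum over \<open>\<parallel>\<phi>\<parallel> \<le> 1\<close> it shows that the map
  \<open>A \<mapsto> A\<^sup>*\<close> has norm at most 1. The map is restricted to the space of operators because members of
  \<^const>\<open>bounded_ops\<close> are extensional.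
\<close>

lemma (in normed_family) adjoint_bounded_op:
  assumes F: "normed_space K F"
  shows "restrict (adjoint K m E F) (carrier (multilinear_ops K m E F))
    \<in> carrier (bounded_ops K (multilinear_ops K m E F) (adjoint_space K m E F))"
proof -
  let ?L = "multilinear_ops K m E F" and ?LK = "multilinear_ops K m E (scalars K)"
  let ?D = "dual K F" and ?T = "adjoint_space K m E F"
  note K = scalar_field
  note sc = scalars_normed_space[OF K]
  interpret F: normed_space K F by fact
  interpret L: normed_space K ?L by (rule multilinear_ops_normed_space[OF F])
  interpret D: normed_space K ?D unfolding dual_def by (rule bounded_ops_normed_space[OF K F sc])
  have dual_add: "(\<phi> \<oplus>\<^bsub>?D\<^esub> \<psi>) y = \<phi> y + \<psi> y" and dual_smult: "(a \<odot>\<^bsub>?D\<^esub> \<phi>) y = a * \<phi> y"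
    if "y \<in> carrier F" for \<phi> \<psi> a y
    using that by (simp_all add: dual_def)
  have val: "A x \<in> carrier F" if "A \<in> carrier ?L" "x \<in> prod_carrier m E" for A x
    using that multilinear_opD(1)[of K m E F A] by simp
  have dual_lin: "y \<in> carrier F \<Longrightarrow> \<phi> (x \<oplus>\<^bsub>F\<^esub> y) = \<phi> x + \<phi> y"
      "a \<in> K \<Longrightarrow> \<phi> (a \<odot>\<^bsub>F\<^esub> x) = a * \<phi> x"
    if "\<phi> \<in> carrier ?D" "x \<in> carrier F" for \<phi> a x y
    using that linear_opD[of K F "scalars K" \<phi>] by (simp_all add: dual_def)
  have app: "adjoint K m E F A \<phi> = (\<lambda>x\<in>prod_carrier m E. \<phi> (A x))" if "\<phi> \<in> carrier ?D" for A \<phi>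
    using that by (simp add: adjoint_def)
  have upper: "nrm F (A x) \<le> nrm ?L A" if A: "A \<in> carrier ?L" and x: "x \<in> unit_ball" for A x
  proof -
    have "bdd_above ((\<lambda>x. nrm F (A x)) ` unit_ball)"
      using multilinear_op_bounded_on_ball[OF F A] by (auto simp: bdd_above_def)
    from cSUP_upper[OF x this] show ?thesis by (simp only: multilinear_ops_simps)
  qed
  have est: "nrm ?LK (adjoint K m E F A \<phi>) \<le> nrm ?L A * nrm ?D \<phi>"
    if A: "A \<in> carrier ?L" and \<phi>: "\<phi> \<in> carrier ?D" for A \<phi>
  proof -
    have "cmod (adjoint K m E F A \<phi> x) \<le> nrm ?L A * nrm ?D \<phi>" if x: "x \<in> unit_ball" for x
    proof -
      have xc: "x \<in> prod_carrier m E" using x by simp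
      have "cmod (\<phi> (A x)) \<le> nrm ?D \<phi> * nrm F (A x)"
        using bounded_op_bound[OF K F sc \<phi>[unfolded dual_def] val[OF A xc]]
        unfolding dual_def scalars_simps .
      also have "\<dots> \<le> nrm ?D \<phi> * nrm ?L A"
        by (intro mult_left_mono upper[OF A x] D.nrm_nonneg[OF \<phi>])
      finally show ?thesis using xc by (simp only: app[OF \<phi>] restrict_apply if_True mult.commute)
    qed
    then show ?thesis
      using origin_in_unit_ball
      unfolding multilinear_ops_simps(5)[of K m E "scalars K"] scalars_simps
      by (intro cSUP_least) blast+
  qed
  have closed: "adjoint K m E F A \<phi> \<in> carrier ?LK" if "A \<in> carrier ?L" "\<phi> \<in> carrier ?D" for A \<phi>
    unfolding app[OF that(2)]
    by (rule bounded_op_comp_multilinear[OF F sc that(2)[unfolded dual_def] that(1)])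
  have adj: "adjoint K m E F A \<in> carrier ?T" if A: "A \<in> carrier ?L" for A
  proof -
    have "linear_op K ?D ?LK (adjoint K m E F A)"
      unfolding linear_op_def
    proof (intro conjI ballI)
      show "adjoint K m E F A \<in> carrier ?D \<rightarrow>\<^sub>E carrier ?LK"
        using closed[OF A] by (simp add: PiE_iff extensional_def) (simp add: adjoint_def)
    next
      fix \<phi> \<psi> assume p: "\<phi> \<in> carrier ?D" "\<psi> \<in> carrier ?D"
      show "adjoint K m E F A (\<phi> \<oplus>\<^bsub>?D\<^esub> \<psi>) = adjoint K m E F A \<phi> \<oplus>\<^bsub>?LK\<^esub> adjoint K m E F A \<psi>"
        using p D.M.a_closed[OF p] val[OF A]
        by (simp add: app dual_add cong: restrict_cong)
    next
      fix a \<phi> assume p: "a \<in> K" "\<phi> \<in> carrier ?D"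
      show "adjoint K m E F A (a \<odot>\<^bsub>?D\<^esub> \<phi>) = a \<odot>\<^bsub>?LK\<^esub> adjoint K m E F A \<phi>"
        using p D.smult_closed[of a \<phi>] val[OF A]
        by (simp add: app dual_smult cong: restrict_cong)
    qed
    then show ?thesis
      unfolding adjoint_space_def bounded_ops_simps using est[OF A] by blast
  qed
  have "linear_op K ?L ?T (restrict (adjoint K m E F) (carrier ?L))"
    unfolding linear_op_def
  proof (intro conjI ballI)
    show "restrict (adjoint K m E F) (carrier ?L) \<in> carrier ?L \<rightarrow>\<^sub>E carrier ?T"
      unfolding restrict_PiE_iff by (intro ballI adj)
  next
    fix A B assume AB: "A \<in> carrier ?L" "B \<in> carrier ?L"
    have "adjoint K m E F (A \<oplus>\<^bsub>?L\<^esub> B) = adjoint K m E F A \<oplus>\<^bsub>?T\<^esub> adjoint K m E F B"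
      unfolding adjoint_space_def bounded_ops_simps
      using val[OF AB(1)] val[OF AB(2)] dual_lin(1)
      by (simp add: adjoint_def cong: restrict_cong)
    then show "restrict (adjoint K m E F) (carrier ?L) (A \<oplus>\<^bsub>?L\<^esub> B) =
        restrict (adjoint K m E F) (carrier ?L) A \<oplus>\<^bsub>?T\<^esub> restrict (adjoint K m E F) (carrier ?L) B"
      using AB L.M.a_closed[OF AB] by (simp only: restrict_apply if_True)
  next
    fix a A assume aA: "a \<in> K" "A \<in> carrier ?L"
    have "adjoint K m E F (a \<odot>\<^bsub>?L\<^esub> A) = a \<odot>\<^bsub>?T\<^esub> adjoint K m E F A"
      unfolding adjoint_space_def bounded_ops_simps
      using val[OF aA(2)] dual_lin(2) aA(1)
      by (simp add: adjoint_def cong: restrict_cong)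
    moreover have "a \<odot>\<^bsub>?L\<^esub> A \<in> carrier ?L" using L.smult_closed aA scalars_simps(1) by blast
    ultimately show "restrict (adjoint K m E F) (carrier ?L) (a \<odot>\<^bsub>?L\<^esub> A) =
        a \<odot>\<^bsub>?T\<^esub> restrict (adjoint K m E F) (carrier ?L) A"
      using aA by (simp only: restrict_apply if_True)
  qed
  moreover have "nrm ?T (restrict (adjoint K m E F) (carrier ?L) A) \<le> 1 * nrm ?L A"
    if A: "A \<in> carrier ?L" for A
  proof -
    have "nrm ?LK (adjoint K m E F A \<phi>) \<le> nrm ?L A"
      if "\<phi> \<in> carrier ?D" "nrm ?D \<phi> \<le> 1" for \<phi>
      using est[OF A that(1)] mult_left_mono[OF that(2) L.nrm_nonneg[OF A]] by linarith
    moreover have "{\<phi> \<in> carrier ?D. nrm ?D \<phi> \<le> 1} \<noteq> {}"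
      using D.M.zero_closed D.nrm_zero zero_le_one by (metis (mono_tags, lifting) empty_Collect_eq)
    ultimately have "nrm ?T (adjoint K m E F A) \<le> nrm ?L A"
      unfolding adjoint_space_def bounded_ops_simps(5) by (intro cSUP_least) blast+
    then show ?thesis using A by (simp only: restrict_apply if_True mult_1)
  qed
  ultimately show ?thesis
    unfolding bounded_ops_simps(1) by (intro CollectI conjI exI[of _ 1] ballI)
qed

theorem proposition3p1:
  fixes K :: "complex set" and m :: nat
    and E :: "nat \<Rightarrow> 'a normed_module" and F :: "'b normed_module"
    and M :: "(('b \<Rightarrow> complex) \<Rightarrow> (nat \<Rightarrow> 'a) \<Rightarrow> complex) set"
  assumes "K = \<real> \<or> K = UNIV"
    and "1 \<le> m"
    and "\<And>i. i \<in> {1..m} \<Longrightarrow> normed_space K (E i)"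
    and "banach_space K F"
    and "closedin (nrm_topology (adjoint_space K m E F)) M"
  shows "closedin (nrm_topology (multilinear_ops K m E F)) (lower_star K m E F M) \<and>
    (submodule M (scalars K) (adjoint_space K m E F) \<longrightarrow>
      closedin (nrm_topology (multilinear_ops K m E F)) (lower_star K m E F M) \<and>
      submodule (lower_star K m E F M) (scalars K) (multilinear_ops K m E F))"
proof -
  let ?L = "multilinear_ops K m E F" and ?T = "adjoint_space K m E F"
  let ?adj = "restrict (adjoint K m E F) (carrier ?L)"
  interpret normed_family K m E using assms(1,3) by (rule normed_family.intro)
  have F: "normed_space K F" using assms(4) by (rule banach_space.axioms)
  have sc: "normed_space K (scalars K)" by (rule scalars_normed_space[OF assms(1)])
  have L: "normed_space K ?L" by (rule multilinear_ops_normed_space[OF F])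
  have T: "normed_space K ?T"
    unfolding adjoint_space_def dual_def
    by (intro bounded_ops_normed_space multilinear_ops_normed_space assms(1) F sc)
  have adj: "?adj \<in> carrier (bounded_ops K ?L ?T)" by (rule adjoint_bounded_op[OF F])
  have star: "lower_star K m E F M = {A \<in> carrier ?L. ?adj A \<in> M}"
    by (auto simp: lower_star_def)
  have "closedin (nrm_topology ?L) (lower_star K m E F M)"
    using closedin_continuous_map_preimage[OF bounded_op_continuous[OF L T adj] assms(5)]
    by (simp only: star normed_space.topspace_nrm_topology[OF L])
  moreover have "linear_op K ?L ?T ?adj" using adj unfolding bounded_ops_simps by blast
  ultimately show ?thesis
    unfolding star using linear_op_preimage_submodule[OF L T] by blast
qed

end
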